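(* Let $(X, \|\cdot\|)$ be a real normed space of dimension at least $2$, and let $\lambda \in [0, 1]$. Then (i) $\rho_{\lambda}(tx, y) = \rho_{\lambda}(x, ty) = t\rho_{\lambda}(x, y)$ for all $x, y\in X$ and all real $t\geq 0$. (ii) $\rho_{\lambda}(tx, y) = \rho_{\lambda}(x, ty) = t\rho_{1 - \lambda}(x, y)$ for all $x, y\in X$ and all real $t<0$. (iii) $\rho_{\lambda}(x, tx + y) = t\|x\|^2 + \rho_{\lambda}(x, y)$ for all $x, y\in X$ and all $t\in\mathbb{R}$. (iv) If $x$ and $y$ are nonzero elements of $X$ such that $x\perp_{\rho_{\lambda}}y$, then $x$ and $y$ are linearly independent. (v) $(\|x\| - \|x - y\|)\|x\|\leq \rho_{\lambda}(x, y) \leq (\|x + y\| - \|x\|)\|x\|$ for all $x, y\in X$. (vi) $|\rho_{\lambda}(x, y)| \leq \|x\|\|y\|$ for all $x, y\in X$. (vii) If $x$ and $y$ are nonzero elements of $X$, then $$\left(1 - \left\|\frac{x}{\|x\|} - \frac{y}{\|y\|}\right\|\right)\|x\|\|y\| \leq \rho_{\lambda}(x, y) \leq \left(\left\|\frac{x}{\|x\|} + \frac{y}{\|y\|}\right\| - 1\right)\|x\|\|y\|.$$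
   Context: For a real normed space $X$ and $x,y\in X$, the norm derivatives are $\rho_{-}(x,y):=\|x\|\lim_{t\to 0^{-}}\frac{\|x+ty\|-\|x\|}{t}$ and $\rho_{+}(x,y):=\|x\|\lim_{t\to 0^{+}}\frac{\|x+ty\|-\|x\|}{t}$ (the limits exist by convexity of the norm). For $\lambda\in[0,1]$, $\rho_{\lambda}(x, y) := \lambda\rho_-(x,y) + (1 - \lambda)\rho_+(x,y)$, and $x\perp_{\rho_{\lambda}}y$ means $\rho_{\lambda}(x,y)=0$. *)

theory Defs
  imports Complex_Main
begin

(* The one-sided limits exist for all x and y, by convexity of the norm. *)

definition rho_minus :: "'a::real_normed_vector \<Rightarrow> 'a \<Rightarrow> real" where
  "rho_minus x y = norm x * Lim (at_left 0) (\<lambda>t. (norm (x + t *\<^sub>R y) - norm x) / t)"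

definition rho_plus :: "'a::real_normed_vector \<Rightarrow> 'a \<Rightarrow> real" where
  "rho_plus x y = norm x * Lim (at_right 0) (\<lambda>t. (norm (x + t *\<^sub>R y) - norm x) / t)"

definition rho :: "real \<Rightarrow> 'a::real_normed_vector \<Rightarrow> 'a \<Rightarrow> real" where
  "rho l x y = l * rho_minus x y + (1 - l) * rho_plus x y"

definition rho_orthogonal :: "real \<Rightarrow> 'a::real_normed_vector \<Rightarrow> 'a \<Rightarrow> bool" where
  "rho_orthogonal l x y \<longleftrightarrow> rho l x y = 0"

(* Linear independence of the family (x, y): the library predicate independent is about sets,
   so the case x = y has to be excluded separately. *)
definition lin_indep_pair :: "'a::real_vector \<Rightarrow> 'a \<Rightarrow> bool" where
  "lin_indep_pair x y \<longleftrightarrow> x \<noteq> y \<and> independent {x, y}"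

(* The library function dim is 0 on infinite-dimensional spaces, so dimension at least 2
   (possibly infinite) is expressed by an independent set of two vectors. *)
definition dim_at_least_two :: "'a::real_vector itself \<Rightarrow> bool" where
  "dim_at_least_two _ \<longleftrightarrow> (\<exists>B :: 'a set. independent B \<and> card B = 2)"

end

theory Submission
  imports Defs "HOL-Analysis.Elementary_Topology"
begin

text \<open>
  Everything reduces to the right derivative. Convexity of the norm makes the difference quotient
  of \<open>s \<mapsto> norm (x + s y)\<close> nondecreasing on \<open>s > 0\<close>, so its limit at \<open>0\<close> exists and is bounded above
  by its value at \<open>s = 1\<close>. Reflecting \<open>s\<close> gives \<open>rho_minus x y = - rho_plus x (- y)\<close>, hence

    \<open>rho l x y = (1 - l) * rho_plus x y - l * rho_plus x (- y)\<close>.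

  Each algebraic law is therefore a law of \<open>rho_plus\<close> alone, proved by a change of variable in the
  limit: \<open>rho_plus\<close> is positively homogeneous in both arguments, a sign can be moved from one
  argument to the other, and adding \<open>t x\<close> to the direction \<open>y\<close> adds \<open>t (norm x)\<^sup>2\<close>. A negative factor
  exchanges the two one-sided terms, which is why \<open>l\<close> becomes \<open>1 - l\<close> there.

  The inequality \<open>- rho_plus x (- y) \<le> rho_plus x y\<close>, again convexity, places the convex combination
  \<open>rho l x y\<close> between its two ends; the bound by the quotient at \<open>s = 1\<close>, for \<open>y\<close> and for \<open>- y\<close>, then
  yields the two-sided estimate. The triangle inequality turns it into the Cauchy-Schwarz bound, and
  homogeneity turns its instance for unit vectors into the angular estimate. Finally, if \<open>y = c x\<close>
  then \<open>rho l x y = c (norm x)\<^sup>2\<close>, which vanishes only for \<open>c = 0\<close> or \<open>x = 0\<close>; so nonzero orthogonal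
  vectors are independent.
\<close>

section \<open>Existence of the one-sided derivatives\<close>

definition norm_slope :: "'a::real_normed_vector \<Rightarrow> 'a \<Rightarrow> real \<Rightarrow> real" where
  "norm_slope x y t = (norm (x + t *\<^sub>R y) - norm x) / t"

text \<open>For \<open>0 < a \<le> b\<close> the point \<open>x + a y\<close> is a convex combination of \<open>x\<close> and \<open>x + b y\<close>.\<close>

lemma norm_slope_mono:
  assumes "0 < a" "a \<le> b"
  shows "norm_slope x y a \<le> norm_slope x y b"
proof -
  define c where "c = a / b"
  have c: "0 \<le> c" "c \<le> 1" "a = c * b" "0 < c" "0 < b"
    using assms by (auto simp: c_def)
  have "x + a *\<^sub>R y = (1 - c) *\<^sub>R x + c *\<^sub>R (x + b *\<^sub>R y)"
    using c by (simp add: algebra_simps)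
  then have "norm (x + a *\<^sub>R y) \<le> norm ((1 - c) *\<^sub>R x) + norm (c *\<^sub>R (x + b *\<^sub>R y))"
    using norm_triangle_ineq by metis
  also have "\<dots> = (1 - c) * norm x + c * norm (x + b *\<^sub>R y)"
    using c by simp
  finally have "norm (x + a *\<^sub>R y) - norm x \<le> c * (norm (x + b *\<^sub>R y) - norm x)"
    by (simp add: algebra_simps)
  then have "norm_slope x y a \<le> c * (norm (x + b *\<^sub>R y) - norm x) / a"
    using assms unfolding norm_slope_def by (simp add: divide_right_mono)
  also have "\<dots> = norm_slope x y b"
    using c by (simp add: norm_slope_def)
  finally show ?thesis .
qed

lemma norm_slope_ge:
  assumes "0 < t"
  shows "- norm y \<le> norm_slope x y t"
proof -
  have "norm x \<le> norm (x + t *\<^sub>R y) + norm (t *\<^sub>R y)"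
    using norm_triangle_ineq4[of "x + t *\<^sub>R y" "t *\<^sub>R y"] by simp
  then show ?thesis
    using assms by (simp add: norm_slope_def field_simps)
qed

definition right_deriv_norm :: "'a::real_normed_vector \<Rightarrow> 'a \<Rightarrow> real" where
  "right_deriv_norm x y = Lim (at_right 0) (norm_slope x y)"

lemma rho_plus_eq: "rho_plus x y = norm x * right_deriv_norm x y"
  by (simp add: rho_plus_def right_deriv_norm_def norm_slope_def[abs_def])

text \<open>A nondecreasing function that is bounded below has a right limit.\<close>

lemma tendsto_right_deriv_norm: "(norm_slope x y \<longlongrightarrow> right_deriv_norm x y) (at_right 0)"
proof -
  have "(norm_slope x y \<longlongrightarrow> Inf (norm_slope x y ` ({0<..} \<inter> UNIV))) (at 0 within ({0<..} \<inter> UNIV))"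
    by (rule Lim_right_bound) (auto intro: norm_slope_mono norm_slope_ge)
  then show ?thesis
    unfolding right_deriv_norm_def by (auto simp: tendsto_Lim)
qed

lemma right_deriv_norm_eqI:
  assumes "(norm_slope x y \<longlongrightarrow> L) (at_right 0)"
  shows "right_deriv_norm x y = L"
  using assms by (simp add: right_deriv_norm_def tendsto_Lim)

lemma rho_minus_eq: "rho_minus x y = - rho_plus x (- y)"
proof -
  have "((\<lambda>t. - norm_slope x (- y) t) \<longlongrightarrow> - right_deriv_norm x (- y)) (at_right 0)"
    by (intro tendsto_minus tendsto_right_deriv_norm)
  then have "((\<lambda>t. (norm (x + t *\<^sub>R y) - norm x) / t) \<longlongrightarrow> - right_deriv_norm x (- y)) (at_left 0)"
    by (simp add: filterlim_at_left_to_right norm_slope_def)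
  then show ?thesis
    by (simp add: rho_minus_def rho_plus_eq tendsto_Lim)
qed

lemma rho_eq_rho_plus: "rho l x y = (1 - l) * rho_plus x y - l * rho_plus x (- y)"
  by (simp add: rho_def rho_minus_eq)

section \<open>Algebraic laws of the right norm derivative\<close>

lemma filterlim_mult_at_right_zero:
  assumes "0 < (t::real)"
  shows "filterlim (\<lambda>s. t * s) (at_right 0) (at_right 0)"
  using filtermap_times_pos_at_right[OF assms, of 0] by (simp add: filterlim_def)

lemma right_deriv_norm_scaleR_right:
  assumes "0 < t"
  shows "right_deriv_norm x (t *\<^sub>R y) = t * right_deriv_norm x y"
proof (rule right_deriv_norm_eqI)
  have "((\<lambda>s. t * norm_slope x y (t * s)) \<longlongrightarrow> t * right_deriv_norm x y) (at_right 0)"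
    by (intro tendsto_mult_left filterlim_compose[OF tendsto_right_deriv_norm]
        filterlim_mult_at_right_zero assms)
  also have "(\<lambda>s. t * norm_slope x y (t * s)) = norm_slope x (t *\<^sub>R y)"
    using assms by (auto simp: norm_slope_def mult.commute)
  finally show "(norm_slope x (t *\<^sub>R y) \<longlongrightarrow> t * right_deriv_norm x y) (at_right 0)" .
qed

text \<open>
  The right derivative itself is invariant under positive scaling of the base point; the homogeneity
  of \<open>rho_plus\<close> in its first argument comes from the factor \<open>norm x\<close> alone.
\<close>

lemma right_deriv_norm_scaleR_left:
  assumes "0 < t"
  shows "right_deriv_norm (t *\<^sub>R x) y = right_deriv_norm x y"
proof (rule right_deriv_norm_eqI)
  have "((\<lambda>s. norm_slope x y (inverse t * s)) \<longlongrightarrow> right_deriv_norm x y) (at_right 0)"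
    using assms by (intro filterlim_compose[OF tendsto_right_deriv_norm]
        filterlim_mult_at_right_zero) simp
  also have "(\<lambda>s. norm_slope x y (inverse t * s)) = norm_slope (t *\<^sub>R x) y"
  proof
    fix s
    have "t *\<^sub>R x + s *\<^sub>R y = t *\<^sub>R (x + (inverse t * s) *\<^sub>R y)"
      using assms by (simp add: scaleR_add_right)
    then have "norm (t *\<^sub>R x + s *\<^sub>R y) = t * norm (x + (inverse t * s) *\<^sub>R y)"
      using assms by simp
    then show "norm_slope x y (inverse t * s) = norm_slope (t *\<^sub>R x) y s"
      using assms by (simp add: norm_slope_def field_simps)
  qed
  finally show "(norm_slope (t *\<^sub>R x) y \<longlongrightarrow> right_deriv_norm x y) (at_right 0)" .
qed

lemma rho_plus_scaleR_right:
  assumes "0 \<le> t"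
  shows "rho_plus x (t *\<^sub>R y) = t * rho_plus x y"
proof (cases "t = 0")
  case True
  have "right_deriv_norm x 0 = 0"
    by (rule right_deriv_norm_eqI) (simp add: norm_slope_def[abs_def])
  then show ?thesis
    using True by (simp add: rho_plus_eq)
next
  case False
  then show ?thesis
    using assms by (simp add: rho_plus_eq right_deriv_norm_scaleR_right)
qed

lemma rho_plus_scaleR_left:
  assumes "0 \<le> t"
  shows "rho_plus (t *\<^sub>R x) y = t * rho_plus x y"
  using assms
  by (cases "t = 0") (simp_all add: rho_plus_eq right_deriv_norm_scaleR_left)

lemma rho_plus_minus_left: "rho_plus (- x) y = rho_plus x (- y)"
proof -
  have "norm (- x + s *\<^sub>R y) = norm (x + s *\<^sub>R (- y))" for s
    using norm_minus_commute[of "s *\<^sub>R y" x] by simp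
  then have "norm_slope (- x) y = norm_slope x (- y)"
    by (simp add: norm_slope_def fun_eq_iff)
  then show ?thesis
    by (simp add: rho_plus_eq right_deriv_norm_def)
qed

text \<open>
  For small \<open>s > 0\<close> one has \<open>x + s (t x + y) = (1 + s t) (x + u y)\<close> with \<open>u = s / (1 + s t)\<close>, and the
  difference quotient splits as \<open>t * norm x\<close> plus the difference quotient of \<open>y\<close> at \<open>u\<close>; moreover \<open>u\<close>
  tends to \<open>0\<close> from the right.
\<close>

lemma right_deriv_norm_add_scaleR:
  "right_deriv_norm x (t *\<^sub>R x + y) = t * norm x + right_deriv_norm x y"
proof (rule right_deriv_norm_eqI)
  define u where "u s = s / (1 + s * t)" for s
  have "((\<lambda>s. 1 + s * t) \<longlongrightarrow> 1 + 0 * t) (at_right 0)"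
    by (intro tendsto_intros)
  then have lim: "((\<lambda>s. 1 + s * t) \<longlongrightarrow> 1) (at_right 0)"
    by simp
  have small: "\<forall>\<^sub>F s in at_right 0. 0 < s \<and> 0 < 1 + s * t"
    using eventually_conj[OF eventually_at_right_less order_tendstoD(1)[OF lim, of 0]] by simp
  have "(u \<longlongrightarrow> 0 / 1) (at_right 0)"
    unfolding u_def by (intro tendsto_divide lim tendsto_ident_at) simp
  moreover have "\<forall>\<^sub>F s in at_right 0. 0 < u s"
    using small by eventually_elim (simp add: u_def)
  ultimately have "filterlim u (at_right 0) (at_right 0)"
    by (intro tendsto_imp_filterlim_at_right) simp_all
  then have "((\<lambda>s. t * norm x + norm_slope x y (u s)) \<longlongrightarrow> t * norm x + right_deriv_norm x y) (at_right 0)"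
    by (intro tendsto_add tendsto_const filterlim_compose[OF tendsto_right_deriv_norm])
  moreover have "\<forall>\<^sub>F s in at_right 0.
      t * norm x + norm_slope x y (u s) = norm_slope x (t *\<^sub>R x + y) s"
    using small
  proof eventually_elim
    case (elim s)
    have "(1 + s * t) * u s = s"
      using elim by (simp add: u_def)
    then have "(1 + s * t) *\<^sub>R (x + u s *\<^sub>R y) = (1 + s * t) *\<^sub>R x + s *\<^sub>R y"
      by (simp only: scaleR_add_right scaleR_scaleR)
    then have "x + s *\<^sub>R (t *\<^sub>R x + y) = (1 + s * t) *\<^sub>R (x + u s *\<^sub>R y)"
      by (simp add: algebra_simps)
    then have n: "norm (x + s *\<^sub>R (t *\<^sub>R x + y)) = (1 + s * t) * norm (x + u s *\<^sub>R y)"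
      using elim by simp
    have "norm_slope x y (u s) = (norm (x + u s *\<^sub>R y) - norm x) * (1 + s * t) / s"
      unfolding norm_slope_def by (simp add: u_def)
    then show ?case
      using elim unfolding norm_slope_def n by (simp add: field_simps)
  qed
  ultimately show "(norm_slope x (t *\<^sub>R x + y) \<longlongrightarrow> t * norm x + right_deriv_norm x y) (at_right 0)"
    by (rule Lim_transform_eventually)
qed

lemma rho_plus_add_scaleR: "rho_plus x (t *\<^sub>R x + y) = t * (norm x)\<^sup>2 + rho_plus x y"
  unfolding rho_plus_eq right_deriv_norm_add_scaleR by (simp add: power2_eq_square algebra_simps)

section \<open>Bounds on the right norm derivative\<close>

text \<open>The quotient at \<open>1\<close> dominates all quotients on \<open>{0<..<1}\<close>, hence their limit.\<close>

lemma rho_plus_le: "rho_plus x y \<le> (norm (x + y) - norm x) * norm x"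
proof -
  have "\<forall>\<^sub>F s in at_right 0. norm_slope x y s \<le> norm_slope x y 1"
    using eventually_at_right_real[of 0 1]
    by (auto elim!: eventually_mono intro: norm_slope_mono)
  then have "right_deriv_norm x y \<le> norm_slope x y 1"
    by (intro tendsto_upperbound[OF tendsto_right_deriv_norm]) simp_all
  then show ?thesis
    by (simp add: rho_plus_eq norm_slope_def mult.commute mult_left_mono)
qed

text \<open>This is \<open>rho_minus x y \<le> rho_plus x y\<close>: \<open>x\<close> is the midpoint of \<open>x + s y\<close> and \<open>x - s y\<close>.\<close>

lemma minus_rho_plus_minus_le: "- rho_plus x (- y) \<le> rho_plus x y"
proof -
  have "- norm_slope x (- y) s \<le> norm_slope x y s" if "0 < s" for s
  proof -
    have "norm ((x + s *\<^sub>R y) + (x - s *\<^sub>R y)) \<le> norm (x + s *\<^sub>R y) + norm (x - s *\<^sub>R y)"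
      by (rule norm_triangle_ineq)
    also have "(x + s *\<^sub>R y) + (x - s *\<^sub>R y) = 2 *\<^sub>R x"
      by (simp add: scaleR_2)
    finally have "- (norm (x - s *\<^sub>R y) - norm x) \<le> norm (x + s *\<^sub>R y) - norm x"
      by simp
    from divide_right_mono[OF this, of s] that show ?thesis
      by (simp add: norm_slope_def minus_divide_left)
  qed
  then have "\<forall>\<^sub>F s in at_right 0. - norm_slope x (- y) s \<le> norm_slope x y s"
    by (auto simp: eventually_at_filter)
  then have "- right_deriv_norm x (- y) \<le> right_deriv_norm x y"
    by (intro tendsto_le[OF _ tendsto_right_deriv_norm tendsto_minus[OF tendsto_right_deriv_norm]])
      simp_all
  then show ?thesis
    by (metis rho_plus_eq mult_left_mono mult_minus_right norm_ge_zero)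
qed

section \<open>Transfer to the weighted norm derivative\<close>

lemma rho_scaleR_nonneg:
  assumes "0 \<le> t"
  shows "rho l (t *\<^sub>R x) y = t * rho l x y" "rho l x (t *\<^sub>R y) = t * rho l x y"
  using rho_plus_scaleR_right[OF assms, of x "- y"] assms
  by (simp_all add: rho_eq_rho_plus rho_plus_scaleR_left rho_plus_scaleR_right algebra_simps)

lemma rho_uminus:
  "rho l (- x) y = - rho (1 - l) x y" "rho l x (- y) = - rho (1 - l) x y"
  by (simp_all add: rho_eq_rho_plus rho_plus_minus_left)

lemma rho_scaleR_neg:
  assumes "t < 0"
  shows "rho l (t *\<^sub>R x) y = t * rho (1 - l) x y" "rho l x (t *\<^sub>R y) = t * rho (1 - l) x y"
  using rho_scaleR_nonneg[of "- t" l "- x" y] rho_scaleR_nonneg[of "- t" l x "- y"] assms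
  by (simp_all add: rho_uminus)

lemma rho_add_scaleR: "rho l x (t *\<^sub>R x + y) = t * (norm x)\<^sup>2 + rho l x y"
proof -
  have "rho_plus x (- (t *\<^sub>R x + y)) = - t * (norm x)\<^sup>2 + rho_plus x (- y)"
    using rho_plus_add_scaleR[of x "- t" "- y"] by simp
  then show ?thesis
    unfolding rho_eq_rho_plus rho_plus_add_scaleR by (simp only:) (simp add: algebra_simps)
qed

lemma rho_scaleR_self: "rho l x (c *\<^sub>R x) = c * (norm x)\<^sup>2"
  using rho_add_scaleR[of l x c 0] rho_scaleR_nonneg(2)[of 0 l x 0] by simp

lemma rho_orthogonal_imp_lin_indep_pair:
  assumes "x \<noteq> 0" "y \<noteq> 0" "rho_orthogonal l x y"
  shows "lin_indep_pair x y"
proof -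
  have "y \<noteq> c *\<^sub>R x" for c
    using assms by (auto simp: rho_orthogonal_def rho_scaleR_self)
  then have "y \<notin> span {x}"
    by (auto simp: span_singleton)
  then have "x \<noteq> y" "independent {y, x}"
    using assms by (auto simp: independent_insert span_base)
  then show ?thesis
    by (simp add: lin_indep_pair_def insert_commute)
qed

lemma rho_bounds:
  assumes "l \<in> {0..1}"
  shows "(norm x - norm (x - y)) * norm x \<le> rho l x y"
    and "rho l x y \<le> (norm (x + y) - norm x) * norm x"
proof -
  have below: "- rho_plus x (- y) \<le> rho l x y"
    using mult_left_mono[OF minus_rho_plus_minus_le[of x y], of "1 - l"] assms
    by (simp add: rho_eq_rho_plus algebra_simps)
  have above: "rho l x y \<le> rho_plus x y"
    using mult_left_mono[OF minus_rho_plus_minus_le[of x y], of l] assms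
    by (simp add: rho_eq_rho_plus algebra_simps)
  show "(norm x - norm (x - y)) * norm x \<le> rho l x y"
    using below rho_plus_le[of x "- y"] by (simp add: algebra_simps)
  show "rho l x y \<le> (norm (x + y) - norm x) * norm x"
    using above rho_plus_le[of x y] by linarith
qed

lemma abs_rho_le:
  assumes "l \<in> {0..1}"
  shows "\<bar>rho l x y\<bar> \<le> norm x * norm y"
proof -
  have "(norm (x + y) - norm x) * norm x \<le> norm y * norm x"
    using norm_triangle_ineq[of x y] by (intro mult_right_mono) simp_all
  moreover have "- norm y * norm x \<le> (norm x - norm (x - y)) * norm x"
    using norm_triangle_ineq4[of x y] by (intro mult_right_mono) simp_all
  ultimately show ?thesis
    using rho_bounds[OF assms, of x y] by (simp add: abs_le_iff mult.commute)
qed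

lemma rho_normalized_bounds:
  assumes "l \<in> {0..1}" "x \<noteq> 0" "y \<noteq> 0"
  shows "(1 - norm (x /\<^sub>R norm x - y /\<^sub>R norm y)) * norm x * norm y \<le> rho l x y"
    and "rho l x y \<le> (norm (x /\<^sub>R norm x + y /\<^sub>R norm y) - 1) * norm x * norm y"
proof -
  define u v where "u = x /\<^sub>R norm x" and "v = y /\<^sub>R norm y"
  have uv: "norm u = 1" "x = norm x *\<^sub>R u" "y = norm y *\<^sub>R v"
    using assms by (simp_all add: u_def v_def)
  have "rho l x y = rho l (norm x *\<^sub>R u) (norm y *\<^sub>R v)"
    using uv by simp
  also have "\<dots> = norm x * norm y * rho l u v"
    by (simp only: rho_scaleR_nonneg norm_ge_zero mult_ac)
  finally have eq: "rho l x y = rho l u v * (norm x * norm y)"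
    by (simp add: mult_ac)
  have "1 - norm (u - v) \<le> rho l u v" "rho l u v \<le> norm (u + v) - 1"
    using rho_bounds[OF assms(1), of u v] uv(1) by simp_all
  then show "(1 - norm (x /\<^sub>R norm x - y /\<^sub>R norm y)) * norm x * norm y \<le> rho l x y"
    and "rho l x y \<le> (norm (x /\<^sub>R norm x + y /\<^sub>R norm y) - 1) * norm x * norm y"
    unfolding eq mult.assoc u_def[symmetric] v_def[symmetric]
    by (simp_all add: mult_right_mono)
qed

theorem theorem2p2:
  fixes l :: real
  assumes dim: "dim_at_least_two TYPE('a::real_normed_vector)"
    and l: "l \<in> {0..1}"
  shows
    "(\<forall>(x::'a) (y::'a) (t::real). t \<ge> 0 \<longrightarrow>
        rho l (t *\<^sub>R x) y = rho l x (t *\<^sub>R y) \<and> rho l x (t *\<^sub>R y) = t * rho l x y) \<and>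
     (\<forall>(x::'a) (y::'a) (t::real). t < 0 \<longrightarrow>
        rho l (t *\<^sub>R x) y = rho l x (t *\<^sub>R y) \<and> rho l x (t *\<^sub>R y) = t * rho (1 - l) x y) \<and>
     (\<forall>(x::'a) (y::'a) (t::real).
        rho l x (t *\<^sub>R x + y) = t * (norm x)\<^sup>2 + rho l x y) \<and>
     (\<forall>(x::'a) (y::'a). x \<noteq> 0 \<longrightarrow> y \<noteq> 0 \<longrightarrow> rho_orthogonal l x y \<longrightarrow> lin_indep_pair x y) \<and>
     (\<forall>(x::'a) (y::'a).
        (norm x - norm (x - y)) * norm x \<le> rho l x y \<and>
        rho l x y \<le> (norm (x + y) - norm x) * norm x) \<and>
     (\<forall>(x::'a) (y::'a). \<bar>rho l x y\<bar> \<le> norm x * norm y) \<and>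
     (\<forall>(x::'a) (y::'a). x \<noteq> 0 \<longrightarrow> y \<noteq> 0 \<longrightarrow>
        (1 - norm (x /\<^sub>R norm x - y /\<^sub>R norm y)) * norm x * norm y \<le> rho l x y \<and>
        rho l x y \<le> (norm (x /\<^sub>R norm x + y /\<^sub>R norm y) - 1) * norm x * norm y)"
  using rho_bounds[OF l] abs_rho_le[OF l] rho_normalized_bounds[OF l]
  by (intro conjI allI impI)
    (simp_all add: rho_scaleR_nonneg rho_scaleR_neg rho_add_scaleR
      rho_orthogonal_imp_lin_indep_pair)

end
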